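(* Let $J\ge 2$, with node indices in $\{1,\dots,J\}$ understood modulo $J$. Suppose that the functions $\beta_k:\mathbb{R}_+\to\mathbb{R}_+$, $0\le k\le J$, are continuous and non-decreasing, and that there exists $z^{(0)}\in\mathbb{R}_+^{J+1}$ such that, coordinate by coordinate, $$z^{(0)}\le\Phi(z^{(0)}),\qquad z^{(0)}\le\Phi(\Phi(z^{(0)})),\qquad \Phi(z^{(0)})<\infty,$$ where for $z=(z_0,z_1,\dots,z_J)$ the vector $\Phi(z)=(\Phi_0(z),\dots,\Phi_J(z))$ is given by $$\Phi_0(z)=\phi_0\Big(Jz_0+2\sum_{i=1}^J z_i\Big),\qquad \Phi_j(z)=\phi_j\big(z_{j-1}+2z_j+z_{j+1}+2z_0\big),\quad 1\le j\le J$$ (in the last formula the indices $j-1$, $j+1$ are taken modulo $J$ in $\{1,\dots,J\}$). Then there exists a unique solution $u\in\mathbb{R}_+^J$ of the fixed point equation $$u_j=\phi_0(u_1+\cdots+u_J)+\phi_{j-1}(u_{j-1}+u_j)+\phi_j(u_j+u_{j+1}),\qquad 1\le j\le J,$$ where, for $j=1$, $\phi_{j-1}$ and $u_{j-1}$ mean $\phi_J$ and $u_J$, and for $j=J$, $u_{j+1}$ means $u_1$.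
   Context: Ring network with $J$ nodes and $J+1$ classes of connections: for $1\le j\le J$, class $j$ uses exactly the two nodes $j$ and $j+1$ (modulo $J$), and class $0$ uses all nodes $1,\dots,J$. The loss-rate function of each class depends only on the sum of the utilizations $u_i$ of the nodes it uses, so it is given by a function of one non-negative real variable. $\mathbb{R}_+=[0,\infty)$. For each class $k\in\{0,1,\dots,J\}$ there are constants $p_k\ge 0$ with $\sum_k p_k=1$, $a_k\ge 0$, $r_k\in(0,1)$, and a function $\beta_k:\mathbb{R}_+\to\mathbb{R}_+$. Set $$\alpha_k=p_k\sqrt{\frac{2}{\pi}}\left(\prod_{n=1}^{\infty}\frac{1-r_k^{2n}}{1-r_k^{2n-1}}\right)\sqrt{a_k},\qquad \phi_k(s)=\frac{\alpha_k}{\sqrt{\beta_k(s)}},$$ with the convention $\phi_k(s)=+\infty$ where $\beta_k(s)=0$. Inequalities between vectors are coordinatewise. *)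

theory Defs
  imports "HOL-Analysis.Analysis" "HOL-Library.FuncSet"
begin

(* The library product runs over n \<ge> 0; the factor with index n is the
   factor with index n + 1 of the product that starts at 1. *)
definition alpha_coeff :: "real \<Rightarrow> real \<Rightarrow> real \<Rightarrow> real" where
  "alpha_coeff p a r =
     p * sqrt (2 / pi) * (\<Prod>n. (1 - r ^ (2 * (n + 1))) / (1 - r ^ (2 * (n + 1) - 1))) * sqrt a"

(* The value is \<infinity> wherever b vanishes, even if c = 0. *)
definition phi_fun :: "real \<Rightarrow> (real \<Rightarrow> real) \<Rightarrow> real \<Rightarrow> ereal" where
  "phi_fun c b s = (if b s = 0 then \<infinity> else ereal (c / sqrt (b s)))"

definition ring_pred :: "nat \<Rightarrow> nat \<Rightarrow> nat" where
  "ring_pred J j = (if j = 1 then J else j - 1)"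

definition ring_succ :: "nat \<Rightarrow> nat \<Rightarrow> nat" where
  "ring_succ J j = (if j = J then 1 else j + 1)"

(* Vectors indexed by {0..J} or {1..J} are functions on nat of which only the
   values at these indices are used. *)
definition ring_Phi :: "nat \<Rightarrow> (nat \<Rightarrow> real \<Rightarrow> ereal) \<Rightarrow> (nat \<Rightarrow> real) \<Rightarrow> nat \<Rightarrow> ereal" where
  "ring_Phi J \<phi> z k =
     (if k = 0 then \<phi> 0 (real J * z 0 + 2 * (\<Sum>i = 1..J. z i))
      else \<phi> k (z (ring_pred J k) + 2 * z k + z (ring_succ J k) + 2 * z 0))"

end

theory Submission
  imports Defs
begin

text \<open>Write \<open>S k\<close> for the set of nodes used by class \<open>k\<close>. The equation
  \<open>u j = (\<Sum>k. if j \<in> S k then \<phi> k (sum u (S k)) else 0)\<close> says that the gradient of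
  \<open>(\<Sum>j. (u j)\<^sup>2 / 2) - (\<Sum>k. G k (sum u (S k)))\<close> vanishes, where \<open>G k\<close> is an antiderivative of
  \<open>\<phi> k\<close>. Freezing each \<open>\<phi> k\<close> to the left of its argument in \<open>\<Phi> z\<close> makes it finite,
  continuous and bounded, so that this potential has an interior minimum on a large box; the
  conditions \<open>z \<le> \<Phi> z\<close> and \<open>z \<le> \<Phi> (\<Phi> z)\<close> ensure that the minimum lies where nothing was changed.
  Uniqueness follows from the monotonicity of the \<open>\<phi> k\<close> alone.\<close>

section \<open>Real analysis: antiderivatives, compact boxes, constrained minima\<close>

text \<open>Taking the interval with infinite endpoints gives one antiderivative for the whole line.
  This matters because coordinates of the box used below may be negative.\<close>

lemma continuous_antiderivative_real:
  fixes f :: "real \<Rightarrow> real"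
  assumes "continuous_on UNIV f"
  obtains G where "\<And>x. (G has_real_derivative f x) (at x)"
proof -
  have "\<exists>G. \<forall>x::real. (-\<infinity>::ereal) < ereal x \<longrightarrow> ereal x < \<infinity> \<longrightarrow>
      (G has_vector_derivative f x) (at x)"
    using assms by (intro einterval_antiderivative) (auto simp: continuous_on_eq_continuous_at)
  then show thesis
    using that by (auto simp: has_real_derivative_iff_has_vector_derivative)
qed

text \<open>This is Tychonoff's theorem for the product topology carried by the function type. All
  indices of the type must be confined to a compact set, including those that are not nodes of the
  network.\<close>

lemma compact_box_fun:
  fixes A :: "'i \<Rightarrow> 'a::topological_space set"
  assumes "\<And>i. compact (A i)"
  shows "compact (PiE UNIV A)"
proof -
  have "compactin (product_topology (\<lambda>i. euclidean) UNIV) (PiE UNIV A)"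
    using assms by (subst compactin_PiE) auto
  then show ?thesis
    by (simp add: euclidean_product_topology)
qed

text \<open>The sign conditions rule out the endpoints: a negative slope at \<open>l\<close> or a
  positive one at \<open>m\<close> would let \<open>g\<close> decrease on moving into the interval,
  with \<open>h\<close> small enough to stay inside. At an interior point Fermat's criterion
  applies.\<close>

lemma has_real_derivative_interior_min:
  fixes g :: "real \<Rightarrow> real"
  assumes der: "(g has_real_derivative d t) (at t)"
    and t: "t \<in> {l..m}" and lm: "l < m"
    and min: "\<And>s. s \<in> {l..m} \<Longrightarrow> g t \<le> g s"
    and lo: "t = l \<Longrightarrow> d t < 0" and hi: "t = m \<Longrightarrow> d t > 0"
  shows "d t = 0"
proof -
  consider "t = l" | "t = m" | "l < t" "t < m" using t by fastforce
  then show ?thesis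
  proof cases
    case 1
    obtain e where e: "e > 0" "\<And>h. h > 0 \<Longrightarrow> h < e \<Longrightarrow> g (t + h) < g t"
      using DERIV_neg_dec_right[OF der lo[OF 1]] by blast
    define h where "h = min (e / 2) (m - l)"
    have "h > 0" "h < e" "t + h \<in> {l..m}" using e(1) lm 1 by (auto simp: h_def min_def)
    then show ?thesis using e(2)[of h] min[of "t + h"] by auto
  next
    case 2
    obtain e where e: "e > 0" "\<And>h. h > 0 \<Longrightarrow> h < e \<Longrightarrow> g (t - h) < g t"
      using DERIV_pos_inc_left[OF der hi[OF 2]] by blast
    define h where "h = min (e / 2) (m - l)"
    have "h > 0" "h < e" "t - h \<in> {l..m}" using e(1) lm 2 by (auto simp: h_def min_def)
    then show ?thesis using e(2)[of h] min[of "t - h"] by auto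
  next
    case 3
    have "min (t - l) (m - t) > 0" using 3 by simp
    moreover have "\<forall>s. \<bar>t - s\<bar> < min (t - l) (m - t) \<longrightarrow> g t \<le> g s"
      by (auto intro!: min simp: abs_if split: if_splits)
    ultimately show ?thesis by (rule DERIV_local_min[OF der])
  qed
qed

section \<open>Existence and uniqueness for general networks with finite rates\<close>

text \<open>The partial derivative of the potential \<open>F\<close> in coordinate \<open>j\<close>
  is \<open>u j\<close> minus the right-hand side of the equation. Since that right-hand side lies
  between 0 and the sum of the \<open>M k\<close>, the derivative points outwards on the faces of a
  large box, so at a minimum over the box every partial derivative in \<open>N\<close>
  vanishes.\<close>

lemma bounded_network_solution_exists:
  fixes S :: "'k \<Rightarrow> 'n set" and f :: "'k \<Rightarrow> real \<Rightarrow> real"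
  assumes fin: "finite N" "finite K" and S: "\<And>k. k \<in> K \<Longrightarrow> S k \<subseteq> N"
    and cont: "\<And>k. k \<in> K \<Longrightarrow> continuous_on UNIV (f k)"
    and f0: "\<And>k s. k \<in> K \<Longrightarrow> 0 \<le> f k s" and fM: "\<And>k s. k \<in> K \<Longrightarrow> f k s \<le> M k"
  obtains u where "\<And>j. j \<in> N \<Longrightarrow> u j = (\<Sum>k | k \<in> K \<and> j \<in> S k. f k (\<Sum>i\<in>S k. u i))"
proof -
  have "\<exists>G. \<forall>k\<in>K. \<forall>x. (G k has_real_derivative f k x) (at x)"
  proof (intro bchoice ballI)
    fix k assume "k \<in> K"
    from continuous_antiderivative_real[OF cont[OF this]]
    show "\<exists>G. \<forall>x. (G has_real_derivative f k x) (at x)" by metis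
  qed
  then obtain G where G: "\<And>k x. k \<in> K \<Longrightarrow> (G k has_real_derivative f k x) (at x)" by blast
  have M0: "0 \<le> M k" if "k \<in> K" for k
    using f0[OF that] fM[OF that] by (meson order_trans)
  define F where "F u = (\<Sum>i\<in>N. (u i)\<^sup>2 / 2) - (\<Sum>k\<in>K. G k (\<Sum>i\<in>S k. u i))" for u
  \<comment> \<open>The added 1, like the lower end -1 of the box, makes the derivative signs on the
    two faces strict.\<close>
  define B where "B = (\<Sum>k\<in>K. M k) + 1"
  have B: "B \<ge> 1" unfolding B_def using M0 by (simp add: sum_nonneg)
  define C :: "('n \<Rightarrow> real) set" where "C = PiE UNIV (\<lambda>_. {-1..B})"
  have "compact C" unfolding C_def by (rule compact_box_fun) simp
  moreover have "C \<noteq> {}" using B by (auto simp: C_def PiE_eq_empty_iff)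
  moreover have "continuous_on C F"
  proof -
    have 1: "continuous_on C (\<lambda>u. u i)" for i
      by (rule continuous_on_subset[OF continuous_on_product_coordinates]) simp
    have GC: "continuous_on UNIV (G k)" if "k \<in> K" for k
      using DERIV_isCont[OF G[OF that]] by (simp add: continuous_at_imp_continuous_on)
    have "continuous_on C (\<lambda>u. G k (\<Sum>i\<in>S k. u i))" if "k \<in> K" for k
      by (rule continuous_on_compose2[OF GC[OF that]]) (auto intro: continuous_on_sum 1)
    then show ?thesis unfolding F_def
      by (intro continuous_on_diff continuous_on_sum continuous_intros 1) auto
  qed
  ultimately obtain u where u: "u \<in> C" "\<And>v. v \<in> C \<Longrightarrow> F u \<le> F v"
    using continuous_attains_inf[of C F] by blast
  show thesis
  proof (rule that[of u])
    fix j assume j: "j \<in> N"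
    define R where "R = (\<Sum>k | k \<in> K \<and> j \<in> S k. f k (\<Sum>i\<in>S k. u i))"
    define g where "g t = F (u(j := t))" for t
    have R0: "0 \<le> R" unfolding R_def using f0 by (intro sum_nonneg) auto
    have "R \<le> (\<Sum>k | k \<in> K \<and> j \<in> S k. M k)" unfolding R_def using fM by (intro sum_mono) auto
    also have "\<dots> \<le> (\<Sum>k\<in>K. M k)" using M0 fin by (intro sum_mono2) auto
    finally have RB: "R < B" by (simp add: B_def)
    have inner: "((\<lambda>t. \<Sum>i\<in>S k. (u(j := t)) i) has_real_derivative of_bool (j \<in> S k)) (at x)"
      if "k \<in> K" for k x
    proof -
      have "((\<lambda>t. \<Sum>i\<in>S k. (u(j := t)) i) has_real_derivative (\<Sum>i\<in>S k. of_bool (i = j))) (at x)"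
        by (intro DERIV_sum) (auto intro!: derivative_eq_intros)
      moreover have "finite (S k)" using S[OF that] fin finite_subset by blast
      ultimately show ?thesis by (simp add: of_bool_def)
    qed
    have sq: "((\<lambda>t. \<Sum>i\<in>N. ((u(j := t)) i)\<^sup>2 / 2) has_real_derivative x) (at x)" for x
    proof -
      have "((\<lambda>t. \<Sum>i\<in>N. ((u(j := t)) i)\<^sup>2 / 2) has_real_derivative
          (\<Sum>i\<in>N. if i = j then x else 0)) (at x)"
        by (intro DERIV_sum) (auto intro!: derivative_eq_intros)
      then show ?thesis using fin j by simp
    qed
    have "(g has_real_derivative u j -
        (\<Sum>k\<in>K. f k (\<Sum>i\<in>S k. (u(j := u j)) i) * of_bool (j \<in> S k))) (at (u j))"
      unfolding g_def F_def
      by (intro DERIV_diff DERIV_sum sq DERIV_chain2[OF G inner])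
    also have "(\<Sum>k\<in>K. f k (\<Sum>i\<in>S k. (u(j := u j)) i) * of_bool (j \<in> S k)) = R"
      unfolding R_def using fin(2) by (simp add: sum.inter_filter of_bool_def if_distrib cong: if_cong)
    finally have der: "(g has_real_derivative u j - R) (at (u j))" .
    have "u j - R = 0"
    \<comment> \<open>\<open>R\<close> is evaluated at the minimiser, so \<open>t - R\<close> is the
      derivative of \<open>g\<close> only at \<open>t = u j\<close>, the one point where the lemma
      uses \<open>d\<close>.\<close>
    proof (rule has_real_derivative_interior_min[where d = "\<lambda>t. t - R", OF der])
      show "u j \<in> {-1..B}" using u(1) by (auto simp: C_def)
      show "g (u j) \<le> g s" if "s \<in> {-1..B}" for s
        using u(2)[of "u(j := s)"] u(1) that by (auto simp: g_def C_def PiE_def Pi_def)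
    qed (use B R0 RB in auto)
    then show "u j = R" by simp
  qed
qed

lemma network_solution_exists:
  fixes S :: "'k \<Rightarrow> 'n set" and f :: "'k \<Rightarrow> real \<Rightarrow> real" and s0 w :: "'k \<Rightarrow> real"
  assumes fin: "finite N" "finite K" and S: "\<And>k. k \<in> K \<Longrightarrow> S k \<subseteq> N"
    and s0: "\<And>k. k \<in> K \<Longrightarrow> s0 k = (\<Sum>i\<in>S k. \<Sum>l | l \<in> K \<and> i \<in> S l. z l)"
    and cont: "\<And>k. k \<in> K \<Longrightarrow> continuous_on {s0 k..} (f k)"
    and anti: "\<And>k. k \<in> K \<Longrightarrow> antimono_on {s0 k..} (f k)"
    and f0: "\<And>k s. k \<in> K \<Longrightarrow> s0 k \<le> s \<Longrightarrow> 0 \<le> f k s"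
    and w: "\<And>k. k \<in> K \<Longrightarrow> w k = f k (s0 k)"
    and zw: "\<And>k. k \<in> K \<Longrightarrow> z k \<le> w k"
    and zfw: "\<And>k. k \<in> K \<Longrightarrow> z k \<le> f k (\<Sum>i\<in>S k. \<Sum>l | l \<in> K \<and> i \<in> S l. w l)"
  obtains u where "\<And>j. j \<in> N \<Longrightarrow> u j = (\<Sum>k | k \<in> K \<and> j \<in> S k. f k (\<Sum>i\<in>S k. u i))"
    and "\<And>k. k \<in> K \<Longrightarrow> s0 k \<le> (\<Sum>i\<in>S k. u i)"
proof -
  \<comment> \<open>Below \<open>s0 k\<close> the value is constantly \<open>w k\<close>, which by
    monotonicity is also the maximum of \<open>h k\<close>; nothing is assumed about
    \<open>f k\<close> there.\<close>
  define h where "h k s = f k (max (s0 k) s)" for k s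
  have anti': "f k t \<le> f k s" if "k \<in> K" "s0 k \<le> s" "s \<le> t" for k s t
    using anti[OF that(1)] that(2,3) by (auto simp: monotone_on_def)
  have hc: "continuous_on UNIV (h k)" if "k \<in> K" for k
    unfolding h_def
    by (intro continuous_on_compose2[OF cont[OF that]] continuous_intros) auto
  have h0: "0 \<le> h k s" if "k \<in> K" for k s unfolding h_def using f0[OF that] by simp
  have hw: "h k s \<le> w k" if "k \<in> K" for k s
    unfolding h_def w[OF that] using that by (intro anti') auto
  obtain u where u: "\<And>j. j \<in> N \<Longrightarrow> u j = (\<Sum>k | k \<in> K \<and> j \<in> S k. h k (\<Sum>i\<in>S k. u i))"
    using bounded_network_solution_exists[of N K S h w, OF fin S hc h0 hw] by blast
  let ?W = "\<lambda>k. \<Sum>i\<in>S k. \<Sum>l | l \<in> K \<and> i \<in> S l. w l"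
  have uW: "(\<Sum>i\<in>S k. u i) \<le> ?W k" if "k \<in> K" for k
  proof (rule sum_mono)
    fix i assume "i \<in> S k"
    then have "i \<in> N" using S[OF that] by blast
    then show "u i \<le> (\<Sum>l | l \<in> K \<and> i \<in> S l. w l)"
      using hw by (subst u) (auto intro!: sum_mono)
  qed
  have zh: "z k \<le> h k (\<Sum>i\<in>S k. u i)" if k: "k \<in> K" for k
  proof -
    \<comment> \<open>With this, the argument of \<open>f k\<close> inside \<open>h k\<close>, a
      maximum, is still at most \<open>?W k\<close>, so \<open>anti'\<close> compares it with
      \<open>zfw\<close>.\<close>
    have "s0 k \<le> ?W k" unfolding s0[OF k] using zw by (auto intro!: sum_mono)
    then show ?thesis unfolding h_def using zfw[OF k] uW[OF k]
      by (intro order_trans[OF zfw[OF k] anti'] k) auto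
  qed
  have su: "s0 k \<le> (\<Sum>i\<in>S k. u i)" if k: "k \<in> K" for k
    unfolding s0[OF k]
  proof (rule sum_mono)
    fix i assume "i \<in> S k"
    then have "i \<in> N" using S[OF k] by blast
    then show "(\<Sum>l | l \<in> K \<and> i \<in> S l. z l) \<le> u i"
      using zh by (subst u) (auto intro!: sum_mono)
  qed
  show thesis
  proof (rule that[of u])
    fix j assume "j \<in> N"
    then show "u j = (\<Sum>k | k \<in> K \<and> j \<in> S k. f k (\<Sum>i\<in>S k. u i))"
      using su by (subst u) (auto simp: h_def max_absorb2 intro!: sum.cong)
  qed (rule su)
qed

text \<open>Pairing the difference of the two fixed point equations with \<open>u - v\<close> and exchanging the
  sums gives the squared norm of \<open>u - v\<close> on the left, and products that are nonpositive by
  monotonicity on the right.\<close>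

lemma network_solution_unique:
  fixes S :: "'k \<Rightarrow> 'n set" and f :: "'k \<Rightarrow> real \<Rightarrow> real"
  assumes fin: "finite N" "finite K" and S: "\<And>k. k \<in> K \<Longrightarrow> S k \<subseteq> N"
    and anti: "\<And>k. k \<in> K \<Longrightarrow> antimono_on (T k) (f k)"
    and uT: "\<And>k. k \<in> K \<Longrightarrow> (\<Sum>i\<in>S k. u i) \<in> T k"
    and vT: "\<And>k. k \<in> K \<Longrightarrow> (\<Sum>i\<in>S k. v i) \<in> T k"
    and u: "\<And>j. j \<in> N \<Longrightarrow> u j = (\<Sum>k | k \<in> K \<and> j \<in> S k. f k (\<Sum>i\<in>S k. u i))"
    and v: "\<And>j. j \<in> N \<Longrightarrow> v j = (\<Sum>k | k \<in> K \<and> j \<in> S k. f k (\<Sum>i\<in>S k. v i))"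
    and j: "j \<in> N"
  shows "u j = v j"
proof -
  define d where "d k = f k (\<Sum>i\<in>S k. u i) - f k (\<Sum>i\<in>S k. v i)" for k
  have "(\<Sum>j\<in>N. (u j - v j)\<^sup>2) = (\<Sum>j\<in>N. \<Sum>k | k \<in> K \<and> j \<in> S k. (u j - v j) * d k)"
  proof (rule sum.cong[OF refl])
    fix j assume "j \<in> N"
    then have "u j - v j = (\<Sum>k | k \<in> K \<and> j \<in> S k. d k)"
      using u[of j] v[of j] by (simp add: d_def sum_subtractf)
    then show "(u j - v j)\<^sup>2 = (\<Sum>k | k \<in> K \<and> j \<in> S k. (u j - v j) * d k)"
      by (simp add: power2_eq_square sum_distrib_left[symmetric])
  qed
  also have "\<dots> = (\<Sum>k\<in>K. \<Sum>j | j \<in> N \<and> j \<in> S k. (u j - v j) * d k)"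
    by (rule sum.swap_restrict[OF fin])
  also have "\<dots> = (\<Sum>k\<in>K. ((\<Sum>i\<in>S k. u i) - (\<Sum>i\<in>S k. v i)) * d k)"
  proof (rule sum.cong[OF refl])
    fix k assume "k \<in> K"
    then have "{j. j \<in> N \<and> j \<in> S k} = S k" using S by blast
    then show "(\<Sum>j | j \<in> N \<and> j \<in> S k. (u j - v j) * d k) =
        ((\<Sum>i\<in>S k. u i) - (\<Sum>i\<in>S k. v i)) * d k"
      by (simp add: sum_subtractf sum_distrib_right[symmetric])
  qed
  also have "\<dots> \<le> 0"
  proof (rule sum_nonpos)
    fix k assume k: "k \<in> K"
    have mono: "f k t \<le> f k s" if "s \<in> T k" "t \<in> T k" "s \<le> t" for s t
      using anti[OF k] that by (auto simp: monotone_on_def)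
    show "((\<Sum>i\<in>S k. u i) - (\<Sum>i\<in>S k. v i)) * d k \<le> 0"
      using mono[OF uT vT, OF k k] mono[OF vT uT, OF k k]
      by (cases "(\<Sum>i\<in>S k. u i) \<le> (\<Sum>i\<in>S k. v i)") (auto simp: d_def mult_le_0_iff)
  qed
  finally have "(\<Sum>j\<in>N. (u j - v j)\<^sup>2) = 0" by (simp add: antisym sum_nonneg)
  then show ?thesis using fin(1) j by (simp add: sum_nonneg_eq_0_iff)
qed

section \<open>Sign of the coefficients\<close>

text \<open>The value of \<open>prodinf\<close> is informative only once convergence is known. Each
  factor is 1 plus a term between 0 and \<open>r ^ n\<close>, so comparison with the geometric
  series gives absolute convergence, and the product is at least 1.\<close>

lemma alpha_coeff_nonneg:
  assumes "0 \<le> p" "0 \<le> a" "0 < r" "r < 1"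
  shows "0 \<le> alpha_coeff p a r"
proof -
  define q where "q n = (1 - r ^ (2 * (n + 1))) / (1 - r ^ (2 * (n + 1) - 1))" for n
  have q: "q n = 1 + r ^ (2 * n + 1) * ((1 - r) / (1 - r ^ (2 * n + 1)))" for n
  proof -
    have "r ^ (2 * n + 1) < 1" using assms by (simp only: power_Suc_less_one flip: Suc_eq_plus1)
    then show ?thesis by (simp add: q_def field_simps)
  qed
  have le1: "0 \<le> (1 - r) / (1 - r ^ (2 * n + 1)) \<and> (1 - r) / (1 - r ^ (2 * n + 1)) \<le> 1" for n
  proof -
    have "r ^ (2 * n + 1) \<le> r" using assms power_decreasing[of 1 "2 * n + 1" r] by simp
    then show ?thesis using assms by (simp add: divide_simps del: power_Suc)
  qed
  have "summable (\<lambda>n. norm (q n - 1))"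
  proof (rule summable_comparison_test[OF _ summable_geometric[of r]])
    show "\<exists>N. \<forall>n\<ge>N. norm (norm (q n - 1)) \<le> r ^ n"
    proof (intro exI allI impI)
      fix n
      have "r ^ (2 * n + 1) * ((1 - r) / (1 - r ^ (2 * n + 1))) \<le> r ^ n * 1"
        using le1 assms by (intro mult_mono power_decreasing) auto
      moreover have "0 \<le> r ^ (2 * n + 1) * ((1 - r) / (1 - r ^ (2 * n + 1)))"
        using le1 assms by (intro mult_nonneg_nonneg) auto
      ultimately have "0 \<le> q n - 1" "q n - 1 \<le> r ^ n"
        unfolding q by (simp_all only: add_diff_cancel_left' mult_1_right)
      then show "norm (norm (q n - 1)) \<le> r ^ n" by simp
    qed
  qed (use assms in simp)
  then have "convergent_prod q"
    using abs_convergent_prod_conv_summable abs_convergent_prod_imp_convergent_prod by blast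
  moreover have "1 \<le> q n" for n
    unfolding q using le1 assms by (simp only: le_add_same_cancel1) (intro mult_nonneg_nonneg, auto)
  ultimately have "1 \<le> prodinf q" by (metis convergent_prod_has_prod prodinf_nonneg)
  then show ?thesis using assms unfolding alpha_coeff_def q_def[symmetric] by simp
qed

section \<open>Combinatorics of the ring and reduction to real equations\<close>

definition ring_nodes :: "nat \<Rightarrow> nat \<Rightarrow> nat set" where
  "ring_nodes J k = (if k = 0 then {1..J} else {k, ring_succ J k})"

text \<open>If each class \<open>l\<close> adds \<open>z l\<close> to every node it uses, this is
  the total over the nodes of class \<open>k\<close>. Thus \<open>z l\<close> is counted once for
  each node shared by \<open>k\<close> and \<open>l\<close>, which explains the coefficients in
  \<open>ring_Phi\<close>.\<close>

definition ring_load :: "nat \<Rightarrow> (nat \<Rightarrow> real) \<Rightarrow> nat \<Rightarrow> real" where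
  "ring_load J z k =
     (\<Sum>i\<in>ring_nodes J k. \<Sum>l | l \<in> {0..J} \<and> i \<in> ring_nodes J l. z l)"

context
  fixes J :: nat
  assumes J: "J \<ge> 2"
begin

lemma ring_pred_in: "j \<in> {1..J} \<Longrightarrow> ring_pred J j \<in> {1..J}"
  using J by (auto simp: ring_pred_def)

lemma ring_succ_in: "j \<in> {1..J} \<Longrightarrow> ring_succ J j \<in> {1..J}"
  using J by (auto simp: ring_succ_def)

lemma ring_succ_pred: "j \<in> {1..J} \<Longrightarrow> ring_succ J (ring_pred J j) = j"
  using J by (auto simp: ring_succ_def ring_pred_def)

lemma ring_pred_succ: "j \<in> {1..J} \<Longrightarrow> ring_pred J (ring_succ J j) = j"
  using J by (auto simp: ring_succ_def ring_pred_def)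

text \<open>Distinctness of neighbours is what \<open>J \<ge> 2\<close> provides: the sums over the
  nodes of a class and over the classes at a node then have no collapsing terms. For
  \<open>J = 2\<close> predecessor and successor coincide, which does no harm.\<close>

lemma ring_pred_neq: "j \<in> {1..J} \<Longrightarrow> ring_pred J j \<noteq> j"
  using J by (auto simp: ring_pred_def)

lemma ring_succ_neq: "j \<in> {1..J} \<Longrightarrow> ring_succ J j \<noteq> j"
  using J by (auto simp: ring_succ_def)

lemma ring_nodes_subset: "k \<in> {0..J} \<Longrightarrow> ring_nodes J k \<subseteq> {1..J}"
  using ring_succ_in[of k] by (auto simp: ring_nodes_def)

lemma sum_ring_nodes:
  fixes u :: "nat \<Rightarrow> real"
  assumes "k \<in> {1..J}"
  shows "(\<Sum>i\<in>ring_nodes J k. u i) = u k + u (ring_succ J k)"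
  using assms ring_succ_neq[OF assms] by (auto simp: ring_nodes_def)

lemma sum_ring_nodes_pred:
  fixes u :: "nat \<Rightarrow> real"
  assumes "j \<in> {1..J}"
  shows "(\<Sum>i\<in>ring_nodes J (ring_pred J j). u i) = u (ring_pred J j) + u j"
  using sum_ring_nodes[OF ring_pred_in[OF assms]] ring_succ_pred[OF assms] by simp

text \<open>Apart from class 0, node \<open>j\<close> is the first node of class \<open>j\<close>
  and the second node of class \<open>ring_pred J j\<close>.\<close>

lemma ring_classes:
  assumes "j \<in> {1..J}"
  shows "{k. k \<in> {0..J} \<and> j \<in> ring_nodes J k} = {0, ring_pred J j, j}"
proof -
  have "k = ring_pred J j" if "k \<in> {1..J}" "j = ring_succ J k" for k
    using ring_pred_succ[of k] that by simp
  then show ?thesis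
    using assms ring_pred_in[OF assms] ring_succ_pred[OF assms]
    by (fastforce simp: ring_nodes_def)
qed

lemma sum_ring_classes:
  fixes g :: "nat \<Rightarrow> real"
  assumes "j \<in> {1..J}"
  shows "(\<Sum>k | k \<in> {0..J} \<and> j \<in> ring_nodes J k. g k) = g 0 + g (ring_pred J j) + g j"
  unfolding ring_classes[OF assms]
  using assms ring_pred_in[OF assms] ring_pred_neq[OF assms] by auto

lemma sum_ring_pred: "(\<Sum>i = 1..J. z (ring_pred J i)) = (\<Sum>i = 1..J. z i :: real)"
  by (rule sum.reindex_bij_witness[of _ "ring_succ J" "ring_pred J"])
    (use ring_pred_in ring_succ_in ring_succ_pred ring_pred_succ in auto)

text \<open>Node \<open>i\<close> carries \<open>z 0 + z (ring_pred J i) + z i\<close>. Summing over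
  all nodes and shifting cyclically gives the argument for class 0; adding two neighbouring nodes
  gives that of the other classes.\<close>

lemma ring_Phi_eq:
  assumes "k \<in> {0..J}"
  shows "ring_Phi J \<phi> z k = \<phi> k (ring_load J z k)"
proof (cases "k = 0")
  case True
  have "ring_load J z 0 = (\<Sum>i = 1..J. z 0 + z (ring_pred J i) + z i)"
    unfolding ring_load_def
    by (rule sum.cong[OF _ sum_ring_classes]) (auto simp: ring_nodes_def)
  also have "\<dots> = real J * z 0 + 2 * (\<Sum>i = 1..J. z i)"
    using sum_ring_pred[of z] by (simp add: sum.distrib)
  finally show ?thesis by (simp add: ring_Phi_def True)
next
  case False
  then have k: "k \<in> {1..J}" using assms by auto
  have "ring_load J z k = (z 0 + z (ring_pred J k) + z k) + (z 0 + z k + z (ring_succ J k))"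
    unfolding ring_load_def
    by (simp only: sum_ring_nodes[OF k] sum_ring_classes[OF k] sum_ring_classes[OF ring_succ_in[OF k]]
        ring_pred_succ[OF k])
  then show ?thesis using False by (simp add: ring_Phi_def algebra_simps)
qed

lemma ring_load_mono:
  assumes "\<And>l. l \<in> {0..J} \<Longrightarrow> z l \<le> w l"
  shows "ring_load J z k \<le> ring_load J w k"
  unfolding ring_load_def using assms by (intro sum_mono) auto

lemma ring_load_nonneg:
  assumes "\<And>l. l \<in> {0..J} \<Longrightarrow> 0 \<le> z l"
  shows "0 \<le> ring_load J z k"
  unfolding ring_load_def using assms by (intro sum_nonneg) auto

text \<open>A finite left-hand side forces each of the nonnegative terms on the right to be finite,
  so no \<open>b k\<close> vanishes at its argument; after that the extended equation is a real
  one.\<close>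

lemma ring_equation_iff:
  assumes c0: "\<And>k. k \<in> {0..J} \<Longrightarrow> 0 \<le> c k"
    and b0: "\<And>k s. k \<in> {0..J} \<Longrightarrow> 0 \<le> s \<Longrightarrow> 0 \<le> b k s"
    and u0: "\<And>j. j \<in> {1..J} \<Longrightarrow> 0 \<le> u j"
  shows "(\<forall>j\<in>{1..J}. ereal (u j) =
        phi_fun (c 0) (b 0) (\<Sum>i = 1..J. u i)
        + phi_fun (c (ring_pred J j)) (b (ring_pred J j)) (u (ring_pred J j) + u j)
        + phi_fun (c j) (b j) (u j + u (ring_succ J j))) \<longleftrightarrow>
    (\<forall>k\<in>{0..J}. 0 < b k (\<Sum>i\<in>ring_nodes J k. u i)) \<and>
    (\<forall>j\<in>{1..J}. u j = (\<Sum>k | k \<in> {0..J} \<and> j \<in> ring_nodes J k.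
        c k / sqrt (b k (\<Sum>i\<in>ring_nodes J k. u i))))"
    (is "?L \<longleftrightarrow> ?pos \<and> ?R")
proof -
  define y where "y k = b k (\<Sum>i\<in>ring_nodes J k. u i)" for k
  have y0: "0 \<le> y k" if "k \<in> {0..J}" for k
    unfolding y_def using that ring_nodes_subset[OF that] u0 by (intro b0 sum_nonneg) auto
  define P where "P k = (if y k = 0 then \<infinity> else ereal (c k / sqrt (y k)))" for k
  have P0: "0 \<le> P k" if "k \<in> {0..J}" for k
    unfolding P_def using c0[OF that] y0[OF that] by auto
  have L: "?L \<longleftrightarrow> (\<forall>j\<in>{1..J}. ereal (u j) = P 0 + P (ring_pred J j) + P j)"
  proof (rule ball_cong[OF refl])
    fix j assume j: "j \<in> {1..J}"
    show "(ereal (u j) =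
        phi_fun (c 0) (b 0) (\<Sum>i = 1..J. u i)
        + phi_fun (c (ring_pred J j)) (b (ring_pred J j)) (u (ring_pred J j) + u j)
        + phi_fun (c j) (b j) (u j + u (ring_succ J j))) \<longleftrightarrow>
      ereal (u j) = P 0 + P (ring_pred J j) + P j"
      by (simp add: phi_fun_def P_def y_def sum_ring_nodes[OF j] sum_ring_nodes_pred[OF j])
        (simp add: ring_nodes_def)
  qed
  have pos: ?pos if ?L
  proof -
    have fin: "P 0 \<noteq> \<infinity> \<and> P j \<noteq> \<infinity>" if "j \<in> {1..J}" for j
    proof -
      have "ereal (u j) = P 0 + P (ring_pred J j) + P j" using \<open>?L\<close> L that by blast
      moreover have "P 0 \<noteq> -\<infinity>" "P (ring_pred J j) \<noteq> -\<infinity>" "P j \<noteq> -\<infinity>"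
        using P0[of 0] P0[of j] P0[of "ring_pred J j"] ring_pred_in[OF that] that by auto
      ultimately show ?thesis by auto
    qed
    have "P k \<noteq> \<infinity>" if "k \<in> {0..J}" for k
      \<comment> \<open>Class 0 is read off at node 1, any other class \<open>k\<close> at node
        \<open>k\<close>.\<close>
      using fin[of 1] fin[of k] that J by (cases "k = 0") auto
    then have "0 < y k" if "k \<in> {0..J}" for k
      using y0[OF that] that unfolding P_def by (metis less_le)
    then show ?pos unfolding y_def by blast
  qed
  have "?L \<longleftrightarrow> ?R" if ?pos
  proof -
    have P: "P k = ereal (c k / sqrt (y k))" if "k \<in> {0..J}" for k
    proof -
      have "0 < y k" using \<open>?pos\<close> that unfolding y_def by blast
      then show ?thesis by (simp add: P_def)
    qed
    show ?thesis unfolding L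
    proof (rule ball_cong[OF refl])
      fix j assume j: "j \<in> {1..J}"
      then have "j \<in> {0..J}" "ring_pred J j \<in> {0..J}" using ring_pred_in[OF j] by auto
      then have "P 0 + P (ring_pred J j) + P j =
          ereal (c 0 / sqrt (y 0) + c (ring_pred J j) / sqrt (y (ring_pred J j)) + c j / sqrt (y j))"
        using P[of 0] P[of j] P[of "ring_pred J j"] by simp
      then show "ereal (u j) = P 0 + P (ring_pred J j) + P j \<longleftrightarrow>
        u j = (\<Sum>k | k \<in> {0..J} \<and> j \<in> ring_nodes J k.
          c k / sqrt (b k (\<Sum>i\<in>ring_nodes J k. u i)))"
        unfolding sum_ring_classes[OF j] y_def[symmetric] by simp
    qed
  qed
  with pos show ?thesis by blast
qed

end

section \<open>The fixed point equation on the ring\<close>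

theorem proposition8:
  fixes J :: nat
    and p a r :: "nat \<Rightarrow> real"
    and \<beta> :: "nat \<Rightarrow> real \<Rightarrow> real"
    and \<phi> :: "nat \<Rightarrow> real \<Rightarrow> ereal"
  assumes J: "J \<ge> 2"
    and p_nonneg: "\<And>k. k \<le> J \<Longrightarrow> p k \<ge> 0"
    and p_sum: "(\<Sum>k = 0..J. p k) = 1"
    and a_nonneg: "\<And>k. k \<le> J \<Longrightarrow> a k \<ge> 0"
    and r_range: "\<And>k. k \<le> J \<Longrightarrow> 0 < r k \<and> r k < 1"
    and \<beta>_nonneg: "\<And>k s. k \<le> J \<Longrightarrow> s \<ge> 0 \<Longrightarrow> \<beta> k s \<ge> 0"
    and \<beta>_cont: "\<And>k. k \<le> J \<Longrightarrow> continuous_on {0..} (\<beta> k)"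
    and \<beta>_mono: "\<And>k. k \<le> J \<Longrightarrow> mono_on {0..} (\<beta> k)"
    and \<phi>_eq: "\<And>k. \<phi> k = phi_fun (alpha_coeff (p k) (a k) (r k)) (\<beta> k)"
    and z0: "\<exists>z :: nat \<Rightarrow> real. (\<forall>k\<in>{0..J}. z k \<ge> 0) \<and>
        (\<forall>k\<in>{0..J}. ereal (z k) \<le> ring_Phi J \<phi> z k) \<and>
        (\<forall>k\<in>{0..J}. ereal (z k) \<le> ring_Phi J \<phi> (\<lambda>i. real_of_ereal (ring_Phi J \<phi> z i)) k) \<and>
        (\<forall>k\<in>{0..J}. ring_Phi J \<phi> z k < \<infinity>)"
  shows "\<exists>!u. u \<in> {1..J} \<rightarrow>\<^sub>E {0..} \<and>
    (\<forall>j\<in>{1..J}. ereal (u j) =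
        \<phi> 0 (\<Sum>i = 1..J. u i)
        + \<phi> (ring_pred J j) (u (ring_pred J j) + u j)
        + \<phi> j (u j + u (ring_succ J j)))"
proof -
  define c where "c k = alpha_coeff (p k) (a k) (r k)" for k
  define f where "f k s = c k / sqrt (\<beta> k s)" for k s
  \<comment> \<open>The set where \<open>\<phi> k\<close> is finite. It is closed upwards because
    \<open>\<beta> k\<close> is non-decreasing.\<close>
  define T where "T k = {s. 0 \<le> s \<and> 0 < \<beta> k s}" for k
  have \<phi>: "\<phi> = (\<lambda>k. phi_fun (c k) (\<beta> k))" using \<phi>_eq by (auto simp: c_def)
  have c0: "0 \<le> c k" if "k \<in> {0..J}" for k
    unfolding c_def using that p_nonneg a_nonneg r_range by (intro alpha_coeff_nonneg) auto
  have b0: "0 \<le> \<beta> k s" if "k \<in> {0..J}" "0 \<le> s" for k s using \<beta>_nonneg that by auto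
  have bmono: "\<beta> k s \<le> \<beta> k t" if "k \<in> {0..J}" "0 \<le> s" "s \<le> t" for k s t
    using \<beta>_mono[of k] that by (auto simp: monotone_on_def)
  have f0: "0 \<le> f k s" if "k \<in> {0..J}" "0 \<le> s" for k s
    unfolding f_def using c0 b0 that by simp
  have anti: "antimono_on (T k) (f k)" if k: "k \<in> {0..J}" for k
    unfolding f_def monotone_on_def
    using k c0 bmono by (auto simp: T_def intro!: divide_left_mono)
  have \<phi>_T: "\<phi> k s = ereal (f k s)" if "s \<in> T k" for k s
    using that by (simp add: \<phi> phi_fun_def f_def T_def)
  have T_up: "t \<in> T k" if "k \<in> {0..J}" "s \<in> T k" "s \<le> t" for k s t
    using bmono[of k s t] that by (auto simp: T_def)
  let ?E = "\<lambda>u. \<forall>j\<in>{1..J}. ereal (u j) =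
        \<phi> 0 (\<Sum>i = 1..J. u i)
        + \<phi> (ring_pred J j) (u (ring_pred J j) + u j)
        + \<phi> j (u j + u (ring_succ J j))"
  let ?S = "\<lambda>(u::nat \<Rightarrow> real) k. \<Sum>i\<in>ring_nodes J k. u i"
  let ?R = "\<lambda>u. \<forall>j\<in>{1..J}. u j = (\<Sum>k | k \<in> {0..J} \<and> j \<in> ring_nodes J k. f k (?S u k))"
  have S0: "0 \<le> ?S u k" if "k \<in> {0..J}" "\<And>j. j \<in> {1..J} \<Longrightarrow> 0 \<le> u j" for k u
    using that(2) ring_nodes_subset[OF J that(1)] by (intro sum_nonneg) auto
  have eq: "?E u \<longleftrightarrow> (\<forall>k\<in>{0..J}. ?S u k \<in> T k) \<and> ?R u" if "\<And>j. j \<in> {1..J} \<Longrightarrow> 0 \<le> u j" for u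
  proof -
    have "?E u \<longleftrightarrow> (\<forall>k\<in>{0..J}. 0 < \<beta> k (?S u k)) \<and> ?R u"
      unfolding \<phi> f_def by (rule ring_equation_iff[OF J c0 b0 that])
    moreover have "?S u k \<in> T k \<longleftrightarrow> 0 < \<beta> k (?S u k)" if "k \<in> {0..J}" for k
      using S0[OF that \<open>\<And>j. j \<in> {1..J} \<Longrightarrow> 0 \<le> u j\<close>] by (auto simp: T_def)
    ultimately show ?thesis by blast
  qed
  have "\<exists>u. u \<in> {1..J} \<rightarrow>\<^sub>E {0..} \<and> ?E u"
  proof -
    obtain z where z: "\<And>k. k \<in> {0..J} \<Longrightarrow> 0 \<le> z k"
      "\<And>k. k \<in> {0..J} \<Longrightarrow> ereal (z k) \<le> ring_Phi J \<phi> z k"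
      "\<And>k. k \<in> {0..J} \<Longrightarrow>
        ereal (z k) \<le> ring_Phi J \<phi> (\<lambda>i. real_of_ereal (ring_Phi J \<phi> z i)) k"
      "\<And>k. k \<in> {0..J} \<Longrightarrow> ring_Phi J \<phi> z k < \<infinity>"
      using z0 by blast
    \<comment> \<open>The conversion sends infinity to 0, but \<open>\<Phi>(z)\<close> is finite by
      assumption, so \<open>w\<close> is the true vector, as \<open>Phi_z\<close> confirms.\<close>
    define w where "w k = real_of_ereal (ring_Phi J \<phi> z k)" for k
    define s0 where "s0 = ring_load J z"
    have s0: "0 \<le> s0 k" for k unfolding s0_def by (rule ring_load_nonneg[OF J z(1)])
    \<comment> \<open>Finiteness of \<open>ring_Phi J \<phi> z k\<close> amounts to
      \<open>\<beta> k (s0 k) \<noteq> 0\<close>; hence the whole half-line from \<open>s0 k\<close>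
      lies in \<open>T k\<close>.\<close>
    have s0T: "s0 k \<in> T k" if k: "k \<in> {0..J}" for k
      using z(4)[OF k] s0[of k] b0[OF k s0[of k]]
      by (auto simp: ring_Phi_eq[OF J k] s0_def[symmetric] \<phi> phi_fun_def T_def less_le split: if_splits)
    have up: "s \<in> T k" if "k \<in> {0..J}" "s0 k \<le> s" for k s
      using T_up[OF that(1) s0T[OF that(1)] that(2)] .
    have Phi_z: "ring_Phi J \<phi> z k = ereal (f k (s0 k))" if k: "k \<in> {0..J}" for k
      using \<phi>_T[OF s0T[OF k]] by (simp add: ring_Phi_eq[OF J k] s0_def)
    have w: "w k = f k (s0 k)" if "k \<in> {0..J}" for k using Phi_z[OF that] by (simp add: w_def)
    have zw: "z k \<le> w k" if "k \<in> {0..J}" for k using z(2)[OF that] Phi_z[OF that] w[OF that] by simp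
    have zfw: "z k \<le> f k (ring_load J w k)" if k: "k \<in> {0..J}" for k
    proof -
      have "ring_load J w k \<in> T k"
        using ring_load_mono[OF J zw] by (intro up[OF k]) (simp add: s0_def)
      from \<phi>_T[OF this] z(3)[OF k] show ?thesis
        by (simp add: ring_Phi_eq[OF J k] w_def[abs_def])
    qed
    have cont: "continuous_on {s0 k..} (f k)" if k: "k \<in> {0..J}" for k
    proof -
      have "continuous_on {s0 k..} (\<beta> k)"
        using \<beta>_cont[of k] k s0[of k] by (auto elim!: continuous_on_subset)
      moreover have "\<beta> k s \<noteq> 0" if "s \<in> {s0 k..}" for s using up[OF k, of s] that by (simp add: T_def)
      ultimately show ?thesis unfolding f_def by (auto intro!: continuous_intros)
    qed
    have anti': "antimono_on {s0 k..} (f k)" if k: "k \<in> {0..J}" for k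
      using up[OF k] by (intro monotone_on_subset[OF anti[OF k]]) auto
    have f0': "0 \<le> f k s" if "k \<in> {0..J}" "s0 k \<le> s" for k s
      using f0[OF that(1)] s0[of k] that(2) by simp
    obtain u where u: "\<And>j. j \<in> {1..J} \<Longrightarrow>
          u j = (\<Sum>k | k \<in> {0..J} \<and> j \<in> ring_nodes J k. f k (?S u k))"
      and su: "\<And>k. k \<in> {0..J} \<Longrightarrow> s0 k \<le> ?S u k"
      using network_solution_exists[of "{1..J}" "{0..J}" "ring_nodes J" s0 z f w,
          OF finite_atLeastAtMost finite_atLeastAtMost ring_nodes_subset[OF J]
            s0_def[THEN fun_cong, unfolded ring_load_def] cont anti' f0' w zw
            zfw[unfolded ring_load_def]]
      by blast
    \<comment> \<open>Uniqueness is claimed among extensional functions, so the values of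
      \<open>u\<close> off the nodes are discarded.\<close>
    define v where "v = restrict u {1..J}"
    have Sv: "?S v k = ?S u k" if "k \<in> {0..J}" for k
      using ring_nodes_subset[OF J that] by (intro sum.cong) (auto simp: v_def)
    have R: "?R v"
    proof
      fix j assume j: "j \<in> {1..J}"
      have "v j = (\<Sum>k | k \<in> {0..J} \<and> j \<in> ring_nodes J k. f k (?S u k))"
        using u[OF j] j by (simp add: v_def)
      also have "\<dots> = (\<Sum>k | k \<in> {0..J} \<and> j \<in> ring_nodes J k. f k (?S v k))"
        using Sv by (intro sum.cong) auto
      finally show "v j = (\<Sum>k | k \<in> {0..J} \<and> j \<in> ring_nodes J k. f k (?S v k))" .
    qed
    have v0: "0 \<le> v j" if "j \<in> {1..J}" for j
      using that u[OF that] su f0' by (auto simp: v_def intro!: sum_nonneg)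
    have "?S v k \<in> T k" if "k \<in> {0..J}" for k
      using up[OF that su[OF that]] Sv[OF that] by simp
    with R have "?E v" using eq[of v, OF v0] by blast
    moreover have "v \<in> {1..J} \<rightarrow>\<^sub>E {0..}" using v0 by (auto simp: v_def)
    ultimately show ?thesis by blast
  qed
  \<comment> \<open>An arbitrary solution is not known to have loads above \<open>s0\<close>; the
    equation itself puts its loads in \<open>T k\<close>, where \<open>f k\<close> is
    antitone.\<close>
  moreover have "u = v" if u: "u \<in> {1..J} \<rightarrow>\<^sub>E {0..}" "?E u" and v: "v \<in> {1..J} \<rightarrow>\<^sub>E {0..}" "?E v" for u v
  proof -
    have "0 \<le> u j" "0 \<le> v j" if "j \<in> {1..J}" for j using u(1) v(1) that by (auto simp: PiE_def Pi_def)
    then have U: "\<forall>k\<in>{0..J}. ?S u k \<in> T k" "?R u" and V: "\<forall>k\<in>{0..J}. ?S v k \<in> T k" "?R v"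
      using eq[of u] eq[of v] u(2) v(2) by blast+
    have "u j = v j" if "j \<in> {1..J}" for j
      by (rule network_solution_unique[OF finite_atLeastAtMost finite_atLeastAtMost
            ring_nodes_subset[OF J] anti _ _ _ _ that]) (use U V in blast)+
    then show ?thesis using u(1) v(1) by (intro PiE_ext) auto
  qed
  ultimately show ?thesis by blast
qed

end
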